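(* Let $A_1$, $A_2$ be finite-dimensional complex vector spaces with $\mathbb{C}$-bases $(e_{1\cdot i})_i$ and $(e_{2\cdot j})_j$. Let $f:A_1\to A_2$ be a $\mathbb{C}$-linear mapping, written in real coordinates (with respect to the associated real bases) as $y^{qj}=\sum_{p\in\{0,1\}}\sum_{i} f^{qj}_{pi}\,x^{pi}$, with $q\in\{0,1\}$ and $f^{qj}_{pi}\in\mathbb{R}$. Then for all $i,j$ $$f^{0j}_{0i}=f^{1j}_{1i},\qquad f^{1j}_{0i}=-f^{0j}_{1i}.$$
   Context: For a complex vector space $A$ with $\mathbb{C}$-basis $(e_i)$, the associated real basis consists of the vectors $e_{0i}=e_i$ and $e_{1i}=\mathrm{i}\,e_i$ ($\mathrm{i}$ the imaginary unit). The real coordinates $x^{0i},x^{1i}\in\mathbb{R}$ of $x\in A$ are defined by $x=\sum_i (x^{0i}+x^{1i}\mathrm{i})e_i$. A mapping $f$ is $\mathbb{C}$-linear if it is additive (real linear) and $f(ca)=cf(a)$ for all $c\in\mathbb{C}$, $a\in A_1$. *)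

theory Defs
  imports Complex_Main
begin

text \<open>Complex vector spaces are given by a type together with a scalar multiplication
  satisfying \<^term>\<open>vector_space\<close>. Bases are indexed families, since the real
  coordinates are double-indexed.\<close>

definition indexed_basis ::
    "(complex \<Rightarrow> 'a::ab_group_add \<Rightarrow> 'a) \<Rightarrow> 'i set \<Rightarrow> ('i \<Rightarrow> 'a) \<Rightarrow> bool" where
  "indexed_basis scale I e \<longleftrightarrow>
     inj_on e I \<and> \<not> module.dependent scale (e ` I) \<and> module.span scale (e ` I) = UNIV"

text \<open>In both definitions below the index \<^term>\<open>p\<close> is meant to range over
  \<^term>\<open>{0, 1::nat}\<close> only.\<close>

definition real_basis ::
    "(complex \<Rightarrow> 'a::ab_group_add \<Rightarrow> 'a) \<Rightarrow> ('i \<Rightarrow> 'a) \<Rightarrow> nat \<Rightarrow> 'i \<Rightarrow> 'a" where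
  "real_basis scale e p i = (if p = 0 then e i else scale \<i> (e i))"

definition real_coord ::
    "(complex \<Rightarrow> 'a::ab_group_add \<Rightarrow> 'a) \<Rightarrow> 'i set \<Rightarrow> ('i \<Rightarrow> 'a) \<Rightarrow> nat \<Rightarrow> 'i \<Rightarrow> 'a \<Rightarrow> real" where
  "real_coord scale I e p i x =
     (let c = module.representation scale (e ` I) x (e i) in if p = 0 then Re c else Im c)"

text \<open>The real coordinates are characterised by
  \<open>x = (\<Sum>i. (x\<^sup>0\<^sup>i + x\<^sup>1\<^sup>i \<i>) e\<^sub>i)\<close>, and they are the coordinates with respect to the
  associated real basis.\<close>

lemma real_coord_iff:
  fixes scale :: "complex \<Rightarrow> 'a::ab_group_add \<Rightarrow> 'a"
  assumes "vector_space scale" and fin: "finite I" and "indexed_basis scale I e"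
  shows "x = (\<Sum>i\<in>I. scale (of_real (c 0 i) + of_real (c 1 i) * \<i>) (e i)) \<longleftrightarrow>
         (\<forall>p\<in>{0,1}. \<forall>i\<in>I. c p i = real_coord scale I e p i x)"
proof -
  interpret vector_space scale by fact
  have inj: "inj_on e I" and ind: "independent (e ` I)" and sp: "span (e ` I) = UNIV"
    using assms(3) by (auto simp: indexed_basis_def)
  have rep_sum: "(\<Sum>i\<in>I. scale (representation (e ` I) y (e i)) (e i)) = y" for y
  proof -
    have "(\<Sum>b\<in>e ` I. scale (representation (e ` I) y b) b) = y"
      by (rule sum_representation_eq[OF ind]) (use sp fin in auto)
    then show ?thesis by (simp add: sum.reindex[OF inj])
  qed
  have rep_e: "representation (e ` I) (e i) (e j) = (if i = j then 1 else 0)"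
    if "i \<in> I" "j \<in> I" for i j
    using representation_basis[OF ind, of "e i"] that inj by (auto simp: inj_on_def)
  have rep_of_sum: "representation (e ` I) (\<Sum>i\<in>I. scale (d i) (e i)) (e j) = d j"
    if j: "j \<in> I" for d j
  proof -
    have "representation (e ` I) (\<Sum>i\<in>I. scale (d i) (e i)) (e j) =
          (\<Sum>i\<in>I. d i * representation (e ` I) (e i) (e j))"
      using sp by (simp add: representation_sum[OF ind] representation_scale[OF ind])
    also have "\<dots> = (\<Sum>i\<in>I. if i = j then d i else 0)"
      by (rule sum.cong) (auto simp: rep_e j)
    also have "\<dots> = d j" using j fin by simp
    finally show ?thesis .
  qed
  show ?thesis
  proof
    assume x: "x = (\<Sum>i\<in>I. scale (of_real (c 0 i) + of_real (c 1 i) * \<i>) (e i))"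
    have "representation (e ` I) x (e i) = of_real (c 0 i) + of_real (c 1 i) * \<i>"
      if "i \<in> I" for i
      unfolding x by (rule rep_of_sum[OF that])
    then show "\<forall>p\<in>{0,1}. \<forall>i\<in>I. c p i = real_coord scale I e p i x"
      by (auto simp: real_coord_def)
  next
    assume c: "\<forall>p\<in>{0,1}. \<forall>i\<in>I. c p i = real_coord scale I e p i x"
    have "of_real (c 0 i) + of_real (c 1 i) * \<i> = representation (e ` I) x (e i)"
      if "i \<in> I" for i
      using c that by (auto simp: real_coord_def complex_eq_iff)
    then show "x = (\<Sum>i\<in>I. scale (of_real (c 0 i) + of_real (c 1 i) * \<i>) (e i))"
      by (simp add: rep_sum)
  qed
qed

lemma real_coord_real_basis:
  fixes scale :: "complex \<Rightarrow> 'a::ab_group_add \<Rightarrow> 'a"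
  assumes "vector_space scale" and "finite I" and "indexed_basis scale I e"
  shows "x = (\<Sum>p\<in>{0,1}. \<Sum>i\<in>I. scale (of_real (c p i)) (real_basis scale e p i)) \<longleftrightarrow>
         (\<forall>p\<in>{0,1}. \<forall>i\<in>I. c p i = real_coord scale I e p i x)"
proof -
  interpret vector_space scale by fact
  have "(\<Sum>p\<in>{0,1}. \<Sum>i\<in>I. scale (of_real (c p i)) (real_basis scale e p i)) =
        (\<Sum>i\<in>I. scale (of_real (c 0 i) + of_real (c 1 i) * \<i>) (e i))"
    by (simp add: real_basis_def scale_left_distrib sum.distrib)
  then show ?thesis using real_coord_iff[OF assms, of x c] by simp
qed

end

theory Submission
  imports Defs
begin

text \<open>Column \<open>(p, i)\<close> of the real matrix of \<open>f\<close> is the image of the real basis vector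
  \<open>e\<^sub>p\<^sub>i\<close>, and \<open>e\<^sub>1\<^sub>i = \<i> e\<^sub>0\<^sub>i\<close>. As \<open>f\<close> commutes with multiplication by \<open>\<i>\<close>, which acts on
  coordinates by \<open>(y\<^sup>0, y\<^sup>1) \<mapsto> (- y\<^sup>1, y\<^sup>0)\<close>, the second column is determined by the first.\<close>

text \<open>The complex coordinate at \<open>e i\<close> gets multiplied by \<open>\<i>\<close>, and
  \<open>\<i> * (u + v * \<i>) = - v + u * \<i>\<close>.\<close>

lemma real_coord_scale_ii:
  fixes scale :: "complex \<Rightarrow> 'a::ab_group_add \<Rightarrow> 'a"
  assumes "vector_space scale" and "indexed_basis scale I e"
  shows "real_coord scale I e 0 i (scale \<i> x) = - real_coord scale I e 1 i x"
    and "real_coord scale I e 1 i (scale \<i> x) = real_coord scale I e 0 i x"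
proof -
  interpret vector_space scale by fact
  have "representation (e ` I) (scale \<i> x) (e i) = \<i> * representation (e ` I) x (e i)"
    using assms(2) by (simp add: indexed_basis_def representation_scale)
  then show "real_coord scale I e 0 i (scale \<i> x) = - real_coord scale I e 1 i x"
    and "real_coord scale I e 1 i (scale \<i> x) = real_coord scale I e 0 i x"
    by (simp_all add: real_coord_def)
qed

lemma real_coord_basis:
  fixes scale :: "complex \<Rightarrow> 'a::ab_group_add \<Rightarrow> 'a"
  assumes "vector_space scale" and "indexed_basis scale I e" and "i \<in> I" "k \<in> I"
  shows "real_coord scale I e p k (e i) = (if p = 0 \<and> k = i then 1 else 0)"
proof -
  interpret vector_space scale by fact
  have inj: "inj_on e I" and ind: "independent (e ` I)"
    using assms(2) by (auto simp: indexed_basis_def)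
  have "representation (e ` I) (e i) (e k) = (if k = i then 1 else 0)"
    using representation_basis[OF ind, of "e i"] assms(3,4) inj by (auto simp: inj_on_def)
  then show ?thesis by (simp add: real_coord_def)
qed

text \<open>The real coordinates of a real basis vector form a Kronecker delta, so pairing them with
  a row \<open>a\<close> extracts one entry; \<open>a\<close> will be a row \<open>F q j\<close> of
  the matrix.\<close>

lemma sum_real_coord_real_basis:
  fixes scale :: "complex \<Rightarrow> 'a::ab_group_add \<Rightarrow> 'a" and a :: "nat \<Rightarrow> 'i \<Rightarrow> real"
  assumes "vector_space scale" and "finite I" and "indexed_basis scale I e"
    and "i \<in> I" and "p \<in> {0,1}"
  shows "(\<Sum>r\<in>{0,1}. \<Sum>k\<in>I. a r k * real_coord scale I e r k (real_basis scale e p i)) = a p i"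
proof -
  \<comment> \<open>\<open>simplified\<close> turns the index \<open>1\<close> into
    \<open>Suc 0\<close>, the form it takes in the goal during simplification.\<close>
  note coord = real_coord_basis[OF assms(1,3,4)] real_coord_scale_ii[OF assms(1,3), simplified]
  have pick: "(\<Sum>k\<in>I. b k * (if k = i then 1 else 0)) = b i" for b :: "'i \<Rightarrow> real"
    using assms(2,4) by (simp add: if_distrib cong: if_cong)
  show ?thesis
    using assms(5) by (auto simp: real_basis_def coord pick)
qed

theorem theorem4p2:
  fixes s1 :: "complex \<Rightarrow> 'a::ab_group_add \<Rightarrow> 'a"
    and s2 :: "complex \<Rightarrow> 'b::ab_group_add \<Rightarrow> 'b"
    and I :: "'i set" and e1 :: "'i \<Rightarrow> 'a"
    and J :: "'j set" and e2 :: "'j \<Rightarrow> 'b"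
    and f :: "'a \<Rightarrow> 'b"
    and F :: "nat \<Rightarrow> 'j \<Rightarrow> nat \<Rightarrow> 'i \<Rightarrow> real"
  assumes "vector_space s1" and "finite I" and "indexed_basis s1 I e1"
    and "vector_space s2" and "finite J" and "indexed_basis s2 J e2"
    and "Vector_Spaces.linear s1 s2 f"
    and "\<And>x q j. q \<in> {0,1} \<Longrightarrow> j \<in> J \<Longrightarrow>
           real_coord s2 J e2 q j (f x) =
             (\<Sum>p\<in>{0,1}. \<Sum>i\<in>I. F q j p i * real_coord s1 I e1 p i x)"
  shows "\<forall>i\<in>I. \<forall>j\<in>J. F 0 j 0 i = F 1 j 1 i \<and> F 1 j 0 i = - F 0 j 1 i"
proof (intro ballI)
  fix i j assume i: "i \<in> I" and j: "j \<in> J"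
  interpret f: Vector_Spaces.linear s1 s2 f by fact
  \<comment> \<open>\<open>F\<close> is known only through its action on all \<open>x\<close>;
    taking \<open>x\<close> to be a real basis vector isolates a single entry.\<close>
  have F: "F q j p i = real_coord s2 J e2 q j (f (real_basis s1 e1 p i))"
    if "q \<in> {0,1}" "p \<in> {0,1}" for q p
    using assms(8)[OF that(1) j] sum_real_coord_real_basis[OF assms(1-3) i that(2)] by simp
  show "F 0 j 0 i = F 1 j 1 i \<and> F 1 j 0 i = - F 0 j 1 i"
    \<comment> \<open>For \<open>p = 1\<close> the vector is
      \<open>f (s1 \<i> (e1 i)) = s2 \<i> (f (e1 i))\<close>; this is where complex linearity
      enters.\<close>
    using real_coord_scale_ii[OF assms(4,6)] by (simp add: F real_basis_def f.scale)
qed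

end
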